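(* Let $R$ be a domain. Then $R$ is fadelian if and only if $R((X))$ is fadelian.
   Context: All rings are nontrivial ($1\neq 0$), unital, associative, and not assumed commutative. A domain is a ring without zero divisors ($xy=0$ implies $x=0$ or $y=0$), not necessarily commutative. A ring $R$ is fadelian if for every $x\in R$ and every nonzero $a\in R$ there exist $b,c\in R$ such that $x=ab+ca$. $R[[X]]$ is the ring of formal power series over $R$ in which the indeterminate $X$ commutes with the elements of $R$, i.e. $\left(\sum_{n\ge 0} a_nX^n\right)\left(\sum_{n\ge 0} b_nX^n\right)=\sum_{n\ge 0}\left(\sum_{i=0}^n a_ib_{n-i}\right)X^n$. $R((X))$ is the ring of formal Laurent series: its elements are $0$ and the elements $X^jP$ with $j\in\mathbb{Z}$, $P\in R[[X]]$ with nonzero constant coefficient, with product $(X^jP)(X^kQ)=X^{j+k}(PQ)$ and the usual addition. *)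

theory Defs
  imports "HOL-Computational_Algebra.Formal_Laurent_Series"
begin

definition fadelian :: "'a::ring_1 itself \<Rightarrow> bool" where
  "fadelian _ \<longleftrightarrow> (\<forall>(x::'a) (a::'a). a \<noteq> 0 \<longrightarrow> (\<exists>b c. x = a * b + c * a))"

end

theory Submission
  imports Defs
begin

text \<open>
  A nonzero Laurent series \<open>A\<close> is, up to a power of the central unit \<open>X\<close>, a power series with
  nonzero constant coefficient \<open>a\<^sub>0\<close>. For such an \<open>A\<close>, comparing coefficients of \<open>X^n\<close> in
  \<open>Q = A * B + C * A\<close> gives an equation of the form
  \<open>a\<^sub>0 * b\<^sub>n + c\<^sub>n * a\<^sub>0 = d\<^sub>n\<close>, where \<open>d\<^sub>n\<close> involves only the earlier coefficients of \<open>B\<close> and \<open>C\<close>.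
  If the coefficient ring is fadelian, each of these equations can be solved in turn
  (\<open>fps_solve_fadelian\<close>), and multiplying by powers of \<open>X\<close> carries the solution over to Laurent
  series (\<open>fadelian_fls\<close>). In the other direction, for constants \<open>x\<close> and \<open>a\<close> the constant coefficients
  of a solution over the Laurent series ring form a solution over the coefficient ring
  (\<open>fadelian_if_fadelian_fls\<close>).
\<close>

text \<open>
  In the equation for \<open>X^n\<close>, the unknown coefficients of index \<open>n\<close> are multiplied only by the constant
  coefficient of \<open>A\<close>, so the pairs \<open>(b\<^sub>n, c\<^sub>n)\<close> can be chosen by well-founded recursion on \<open>n\<close>.
\<close>

lemma fps_solve_fadelian:
  fixes A Q :: "'a::ring_1 fps"
  assumes fad: "fadelian TYPE('a)" and A0: "A $ 0 \<noteq> 0"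
  shows "\<exists>B C. Q = A * B + C * A"
proof -
  define P where "P f n r \<longleftrightarrow>
      Q $ n = (A $ 0 * fst r + snd r * A $ 0) +
        (\<Sum>i<n. A $ (n - i) * fst (f i) + snd (f i) * A $ (n - i))"
    for f :: "nat \<Rightarrow> 'a \<times> 'a" and n r
  have "\<exists>f. \<forall>n. P f n (f n)"
  proof (rule dependent_wellorder_choice)
    show "P f n r = P g n r" if "\<And>i. i < n \<Longrightarrow> f i = g i" for f g n r
      using that by (simp add: P_def)
    show "\<exists>r. P f n r" for f n
    proof -
      from fad A0 obtain b c where
        "Q $ n - (\<Sum>i<n. A $ (n - i) * fst (f i) + snd (f i) * A $ (n - i)) = A $ 0 * b + c * A $ 0"
        unfolding fadelian_def by blast
      then have "P f n (b, c)"
        unfolding P_def by (simp add: diff_eq_eq)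
      then show ?thesis ..
    qed
  qed
  then obtain f where f: "\<And>n. P f n (f n)"
    by blast
  define B C where "B = Abs_fps (\<lambda>n. fst (f n))" and "C = Abs_fps (\<lambda>n. snd (f n))"
  have "Q $ n = (A * B + C * A) $ n" for n
  proof -
    have "(A * B) $ n = (\<Sum>i\<le>n. A $ (n - i) * B $ i)"
      unfolding fps_mult_nth atLeast0AtMost
      by (rule sum.reindex_bij_witness[where i = "\<lambda>i. n - i" and j = "\<lambda>i. n - i"]) auto
    moreover have "(C * A) $ n = (\<Sum>i\<le>n. C $ i * A $ (n - i))"
      by (simp add: fps_mult_nth atLeast0AtMost)
    ultimately have "(A * B + C * A) $ n = (\<Sum>i\<le>n. A $ (n - i) * B $ i + C $ i * A $ (n - i))"
      by (simp add: sum.distrib)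
    also have "\<dots> = Q $ n"
      using f[of n] by (simp add: P_def B_def C_def lessThan_Suc_atMost[symmetric] add.commute)
    finally show ?thesis ..
  qed
  then show ?thesis
    by (metis fps_ext)
qed

text \<open>
  Shifting is multiplication by a power of the central element \<open>X\<close>, so it moves freely between the
  factors. Both series are written as shifts of power series, and the difference of the two
  subdegrees is absorbed into the solution.
\<close>

lemma fadelian_fls:
  assumes "fadelian TYPE('a::ring_1)"
  shows "fadelian TYPE('a fls)"
  unfolding fadelian_def
proof (intro allI impI)
  fix x a :: "'a fls"
  assume "a \<noteq> 0"
  define A where "A = fls_base_factor_to_fps a"
  define Q where "Q = fls_base_factor_to_fps x"
  define j where "j = fls_subdegree a"
  define k where "k = fls_subdegree x"
  have a: "a = fls_shift (-j) (fps_to_fls A)" and x: "x = fls_shift (-k) (fps_to_fls Q)"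
    unfolding A_def Q_def j_def k_def by (rule fls_conv_base_factor_to_fps_shift_subdegree)+
  have "A $ 0 \<noteq> 0"
    using \<open>a \<noteq> 0\<close> by (simp add: A_def)
  with assms obtain B C where "Q = A * B + C * A"
    using fps_solve_fadelian by blast
  then have "x = a * fls_shift (j - k) (fps_to_fls B) + fls_shift (j - k) (fps_to_fls C) * a"
    by (simp add: a x fls_times_fps_to_fls fps_to_fls_plus fls_shifted_times_simps)
  then show "\<exists>b c. x = a * b + c * a"
    by blast
qed

lemma fadelian_if_fadelian_fls:
  assumes "fadelian TYPE('a::ring_1 fls)"
  shows "fadelian TYPE('a)"
  unfolding fadelian_def
proof (intro allI impI)
  fix x a :: 'a
  assume "a \<noteq> 0"
  then have "fls_const a \<noteq> 0"
    by simp
  with assms obtain B C where "fls_const x = fls_const a * B + C * fls_const a"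
    unfolding fadelian_def by blast
  then have "fls_nth (fls_const x) 0 = fls_nth (fls_const a * B + C * fls_const a) 0"
    by simp
  then have "x = a * fls_nth B 0 + fls_nth C 0 * a"
    by simp
  then show "\<exists>b c. x = a * b + c * a"
    by blast
qed

theorem theorem3:
  shows "fadelian TYPE('a::ring_1_no_zero_divisors) \<longleftrightarrow> fadelian TYPE('a fls)"
  using fadelian_fls fadelian_if_fadelian_fls by blast

end
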